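(* Let $A,B\in\mathbb{R}$. All spectral curves of off-diagonal K-symmetric potentials have genus one. Higher spectral genus examples must come from (K-symmetric) potentials with non-zero diagonal.
   Context: For arbitrary real numbers $A,B$ and $\lambda\in\mathbb{C}^\ast$ the K-matrix is $$K(\lambda)=\begin{pmatrix}4A-4B\lambda & \lambda-\lambda^{-1}\\ \lambda-\lambda^{-1} & 4A-4B\lambda^{-1}\end{pmatrix}.$$ A (finite-gap) potential of degree $d$ is a Laurent polynomial $\xi_\lambda=\sum_{k=-1}^{d}\hat\xi_k\lambda^k$ with $\hat\xi_k\in\mathrm{sl}_2(\mathbb{C})$ satisfying $\hat\xi_k=-\overline{\hat\xi_{d-k-1}}^{\,t}$ for $-1\le k\le d$, and $\hat\xi_{-1}=\begin{pmatrix}0&c\\0&0\end{pmatrix}$ with $c\in i\mathbb{R}_+$ (positive imaginary). It is K-symmetric if $K(\lambda)\,\xi_\lambda+\overline{\xi_{\bar\lambda}}^{\,t}K(\lambda)=0$ for all $\lambda\in\mathbb{C}^\ast$, where $\overline{\xi_{\bar\lambda}}^{\,t}=\sum_k\overline{\hat\xi_k}^{\,t}\lambda^k$. It is off-diagonal if its diagonal entries vanish identically in $\lambda$, and has non-zero diagonal otherwise. The spectral curve $\Sigma$ of $\xi_\lambda$ is the 2-point compactification of $\Sigma^\ast=\{(\nu,\lambda)\in\mathbb{C}^2\mid \nu^2=-\det\xi_\lambda\}$. When $\xi=p\,\tilde\xi$ for a polynomial $p$ in $\lambda$, then after renormalization $\xi$ and $\tilde\xi$ give the same spectral curve, since the roots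 of $p^2$ all have even order; the genus is that of the renormalized curve.
   Formalization: Genus one is claimed only for A≠0, |A|≠|B| (for A=-B≠0, ξ=[[0,i/λ],[i,0]] has ν²=-1/λ, genus 0; A=B≠0 and A=0≠B also fail), and the higher-genus claim only for (A,B)≠(0,0), since at A=B=0 an off-diagonal K-symmetric potential of degree 2 has genus 2. *)

theory Defs
  imports
    "HOL-Complex_Analysis.Complex_Analysis"
    "HOL-Computational_Algebra.Computational_Algebra"
    "HOL-Computational_Algebra.Field_as_Ring"
begin

definition K_matrix :: "real \<Rightarrow> real \<Rightarrow> complex \<Rightarrow> complex^2^2" where
  "K_matrix A B l = vector
     [vector [4 * of_real A - 4 * of_real B * l, l - inverse l],
      vector [l - inverse l, 4 * of_real A - 4 * of_real B * inverse l]]"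

definition conj_transpose :: "complex^2^2 \<Rightarrow> complex^2^2" where
  "conj_transpose M = (\<chi> i j. cnj (M $ j $ i))"

text \<open>A potential of degree \<open>d\<close> is given by its coefficient family; only the coefficients with
  index in \<open>{-1..d}\<close> matter.\<close>

definition laurent :: "nat \<Rightarrow> (int \<Rightarrow> complex^2^2) \<Rightarrow> complex \<Rightarrow> complex^2^2" where
  "laurent d \<xi> l = (\<chi> i j. \<Sum>k = -1..int d. \<xi> k $ i $ j * l powi k)"

definition potential :: "nat \<Rightarrow> (int \<Rightarrow> complex^2^2) \<Rightarrow> bool" where
  "potential d \<xi> \<longleftrightarrow>
     (\<forall>k\<in>{-1..int d}. trace (\<xi> k) = 0 \<and> \<xi> k = - conj_transpose (\<xi> (int d - k - 1))) \<and>
     (\<exists>y::real. y > 0 \<and> \<xi> (-1) = vector [vector [0, \<i> * of_real y], vector [0, 0]])"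

definition K_symmetric :: "real \<Rightarrow> real \<Rightarrow> nat \<Rightarrow> (int \<Rightarrow> complex^2^2) \<Rightarrow> bool" where
  "K_symmetric A B d \<xi> \<longleftrightarrow>
     (\<forall>l. l \<noteq> 0 \<longrightarrow>
        K_matrix A B l ** laurent d \<xi> l + conj_transpose (laurent d \<xi> (cnj l)) ** K_matrix A B l = 0)"

definition off_diagonal :: "nat \<Rightarrow> (int \<Rightarrow> complex^2^2) \<Rightarrow> bool" where
  "off_diagonal d \<xi> \<longleftrightarrow> (\<forall>l. l \<noteq> 0 \<longrightarrow> (\<forall>i. laurent d \<xi> l $ i $ i = 0))"

text \<open>The affine part of the spectral curve, as a set of pairs \<open>(\<nu>, \<lambda>)\<close> with \<open>\<lambda> \<noteq> 0\<close>.\<close>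

definition spectral_curve :: "nat \<Rightarrow> (int \<Rightarrow> complex^2^2) \<Rightarrow> (complex \<times> complex) set" where
  "spectral_curve d \<xi> = {(n, l). l \<noteq> 0 \<and> n\<^sup>2 = - det (laurent d \<xi> l)}"

text \<open>
  The genus of a curve \<open>S = {(\<nu>, \<lambda>). \<lambda> \<noteq> 0 \<and> \<nu>\<^sup>2 = a(\<lambda>)}\<close> with \<open>a\<close> a nonzero Laurent polynomial is
  the dimension of the space of holomorphic differentials on the compact Riemann surface
  obtained by normalizing and compactifying \<open>S\<close>.  Neither step is carried out
  by hand.  Near any of its points, including those over \<open>\<lambda> = 0\<close>, over \<open>\<lambda> = \<infinity>\<close> and over the
  singular points of \<open>S\<close>, the compact surface is seen through holomorphic maps from a
  punctured disc into \<open>S\<close> that are meromorphic at the puncture and nonconstant.  Every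
  meromorphic differential is \<open>(u + v \<nu>) d\<lambda>\<close> for unique rational functions \<open>u\<close>, \<open>v\<close> of \<open>\<lambda>\<close>, and
  it is holomorphic iff its pullback under all these maps extends holomorphically.

  As only the normalization is seen, replacing \<open>\<xi>\<close> by \<open>p \<xi>\<close>, with \<open>p\<close> a nonzero polynomial, i.e.
  \<open>\<nu>\<close> by \<open>p(\<lambda>) \<nu>\<close>, does not change the genus.  If \<open>a\<close> is
  a square, \<open>S\<close> has two rational components and the genus is 0.
\<close>

definition branch_param ::
    "(complex \<times> complex) set \<Rightarrow> (complex \<Rightarrow> complex) \<Rightarrow> (complex \<Rightarrow> complex) \<Rightarrow> bool" where
  "branch_param S n l \<longleftrightarrow>
     n meromorphic_on {0} \<and> l meromorphic_on {0} \<and>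
     (\<forall>\<^sub>F t in at 0. (n t, l t) \<in> S) \<and>
     \<not> (\<exists>c. \<forall>\<^sub>F t in at 0. l t = c)"

definition eval_fract :: "complex poly fract \<Rightarrow> complex \<Rightarrow> complex" where
  "eval_fract u z = poly (fst (quot_of_fract u)) z / poly (snd (quot_of_fract u)) z"

definition holomorphic_differentials ::
    "(complex \<times> complex) set \<Rightarrow> (complex poly fract \<times> complex poly fract) set" where
  "holomorphic_differentials S =
     {(u, v). \<forall>n l. branch_param S n l \<longrightarrow>
        (\<exists>h. h analytic_on {0} \<and>
             (\<forall>\<^sub>F t in at 0. (eval_fract u (l t) + eval_fract v (l t) * n t) * deriv l t = h t))}"

definition differential_scale ::
    "complex \<Rightarrow> complex poly fract \<times> complex poly fract \<Rightarrow> complex poly fract \<times> complex poly fract" where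
  "differential_scale c w = (to_fract [:c:] * fst w, to_fract [:c:] * snd w)"

lemma vector_space_differential_scale: "vector_space differential_scale"
proof
  fix a b :: complex and x y :: "complex poly fract \<times> complex poly fract"
  have add: "to_fract [:a + b:] = to_fract [:a:] + to_fract [:b:]"
    by (simp flip: to_fract_add)
  have mult: "to_fract [:a * b:] = to_fract [:a:] * to_fract [:b:]"
    by (simp flip: to_fract_mult)
  have one: "to_fract [:1::complex:] = 1"
    by (simp flip: one_pCons)
  show "differential_scale a (x + y) = differential_scale a x + differential_scale a y"
    by (simp add: differential_scale_def prod_eq_iff algebra_simps)
  show "differential_scale (a + b) x = differential_scale a x + differential_scale b x"
    by (simp add: differential_scale_def prod_eq_iff add algebra_simps)
  show "differential_scale a (differential_scale b x) = differential_scale (a * b) x"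
    by (simp add: differential_scale_def prod_eq_iff mult algebra_simps)
  show "differential_scale 1 x = x"
    by (simp add: differential_scale_def prod_eq_iff one)
qed

definition genus :: "(complex \<times> complex) set \<Rightarrow> nat" where
  "genus S = vector_space.dim differential_scale (holomorphic_differentials S)"

end

(* For an off-diagonal K-symmetric potential with entries b, c, the symmetry reads
   (A - B l) l b = (A l - B) c.  If A \<noteq> 0 and |A| \<noteq> |B| the linear factors are coprime, so
   l b = (A l - B) p and c = (A - B l) p for a polynomial p, and the curve is
   nu^2 = b c = l (A l - B) (A - B l) (p / l)^2 with three distinct finite branch points: an
   elliptic curve.  In the remaining cases the same identity gives (l nu)^2 = D p^2 with D = l^2
   or D = +-l.

   On (l nu)^2 = D p^2 write a holomorphic differential as (u + v nu) dl.  Exchanging the sheets,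
   u dl and v nu dl are both holomorphic.  The parameters l = z + t^2 and l = 1/t^2 cover a
   neighbourhood of every point of the sphere, and D has a square root along them.  Evaluating there,
   u has no poles and vanishes at infinity, and v D p / l has no poles and is bounded at
   infinity when deg D <= 3.  Hence u = 0 and v is a multiple of l / (D p).  When D is a cubic with
   distinct roots this multiple is holomorphic: its pullback g satisfies g^2 = l'^2 / D(l), which
   has a pole of order at most one, hence none, because the order of g^2 is even. *)
theory Submission
  imports Defs
begin

section \<open>Growth and removable singularities of meromorphic functions at a point\<close>

lemma is_pole_not_bigo_1:
  fixes f :: "complex \<Rightarrow> complex"
  assumes "f \<in> O[at z](\<lambda>_. 1)"
  shows "\<not> is_pole f z"
proof
  assume "is_pole f z"
  then have lim: "filterlim f at_infinity (at z)"
    by (simp add: is_pole_def)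
  obtain C where C: "\<forall>\<^sub>F t in at z. norm (f t) \<le> C"
    using assms by (auto elim!: landau_o.bigE)
  have "\<forall>\<^sub>F t in at z. norm (f t) \<ge> \<bar>C\<bar> + 1"
    using lim by (auto simp: filterlim_at_infinity[OF order.refl])
  with C have "\<forall>\<^sub>F t in at z. False"
    by eventually_elim auto
  then show False by simp
qed

text \<open>Being meromorphic excludes an essential singularity, so without a pole a limit exists
  and \<open>remove_sings\<close> fills the puncture.\<close>

lemma meromorphic_extends_if_not_pole:
  fixes f :: "complex \<Rightarrow> complex"
  assumes "f meromorphic_on {z}" "\<not> is_pole f z"
  obtains h where "h analytic_on {z}" "\<forall>\<^sub>F t in at z. f t = h t"
proof -
  have iso: "isolated_singularity_at f z" and "not_essential f z"
    using assms by (auto simp: meromorphic_at_iff)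
  then obtain c where "f \<midarrow>z\<rightarrow> c"
    using assms(2) by (auto simp: not_essential_def)
  with iso have "remove_sings f analytic_on {z}"
    by (rule remove_sings_analytic_at)
  moreover have "\<forall>\<^sub>F t in at z. f t = remove_sings f t"
    using eventually_remove_sings_eq_at[OF iso] by eventually_elim simp
  ultimately show ?thesis by (rule that)
qed

lemma analytic_bigo_1:
  fixes h :: "complex \<Rightarrow> complex"
  assumes "h analytic_on {z}"
  shows "h \<in> O[at z](\<lambda>_. 1)"
  using analytic_at_imp_isCont[OF assms]
  by (intro bigoI_tendsto[where c = "h z"]) (auto simp: isCont_def)

text \<open>The inverse tends to 0, so it extends analytically with a zero at the origin, and the
  linear Taylor bound applies.\<close>

lemma pole_inverse_bigo:
  fixes f :: "complex \<Rightarrow> complex"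
  assumes "f meromorphic_on {0}" "is_pole f 0"
  shows "(\<lambda>t. inverse (f t)) \<in> O[at 0](\<lambda>t. t)"
proof -
  have lim: "((\<lambda>t. inverse (f t)) \<longlongrightarrow> 0) (at 0)"
    using assms(2) unfolding is_pole_def by (rule tendsto_inverse_0[THEN filterlim_compose])
  then have "\<not> is_pole (\<lambda>t. inverse (f t)) 0"
    unfolding is_pole_def
    using not_tendsto_and_filterlim_at_infinity[of "at (0::complex)"] by auto
  moreover have "(\<lambda>t. inverse (f t)) meromorphic_on {0}"
    using assms(1) by (rule meromorphic_on_inverse)
  ultimately obtain h where h: "h analytic_on {0}" and eq: "\<forall>\<^sub>F t in at 0. inverse (f t) = h t"
    using meromorphic_extends_if_not_pole by blast
  have "(h \<longlongrightarrow> 0) (at 0)"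
    using lim eq by (rule Lim_transform_eventually)
  moreover have "(h \<longlongrightarrow> h 0) (at 0)"
    using analytic_at_imp_isCont[OF h] by (simp add: isCont_def)
  ultimately have "h 0 = 0"
    using LIM_unique by blast
  moreover have "h field_differentiable at 0"
    using h by (simp add: analytic_on_imp_differentiable_at)
  ultimately have "h \<in> O[at 0](\<lambda>t. t)"
    using taylor_bigo_linear[of h 0 UNIV] by simp
  then show ?thesis
    using landau_o.big.in_cong[OF eq] by blast
qed

text \<open>Parity: a pole of \<open>g\<close> of order m \<ge> 1 gives \<open>t * (g t)^2\<close> a
  pole of order 2m - 1 \<ge> 1. A bound that seems to leave room for a simple pole of
  \<open>g^2\<close> therefore leaves room for none.\<close>

lemma meromorphic_extends_if_square_bigo:
  fixes g :: "complex \<Rightarrow> complex"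
  assumes mero: "g meromorphic_on {0}" and bound: "(\<lambda>t. t * (g t)\<^sup>2) \<in> O[at 0](\<lambda>_. 1)"
  obtains h where "h analytic_on {0}" "\<forall>\<^sub>F t in at 0. g t = h t"
proof (rule meromorphic_extends_if_not_pole[OF mero])
  show "\<not> is_pole g 0"
  proof
    assume pole: "is_pole g 0"
    then have nz: "\<forall>\<^sub>F t in at 0. g t \<noteq> 0"
      by (rule non_zero_neighbour_pole)
    \<comment> \<open>Multiplying the hypothesis by this bound cancels \<open>g\<close> and leaves
      \<open>t = O(t^2)\<close>, which is absurd near 0.\<close>
    have "(\<lambda>t. (inverse (g t))\<^sup>2) \<in> O[at 0](\<lambda>t. t\<^sup>2)"
      by (intro landau_o.big_power pole_inverse_bigo mero pole)
    from landau_o.big_mult[OF bound this]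
    have "(\<lambda>t. t * (g t)\<^sup>2 * (inverse (g t))\<^sup>2) \<in> O[at 0](\<lambda>t. t\<^sup>2)"
      by simp
    also have "(\<lambda>t. t * (g t)\<^sup>2 * (inverse (g t))\<^sup>2) \<in> O[at 0](\<lambda>t. t\<^sup>2) \<longleftrightarrow>
               (\<lambda>t. t) \<in> O[at 0](\<lambda>t::complex. t\<^sup>2)"
      by (intro landau_o.big.in_cong) (use nz in eventually_elim, auto simp: field_simps)
    finally obtain C where C: "\<forall>\<^sub>F t in at (0::complex). norm t \<le> C * norm (t\<^sup>2)"
      by (auto elim!: landau_o.bigE)
    have "\<forall>\<^sub>F t in at (0::complex). t \<noteq> 0"
      by (simp add: eventually_at_filter)
    with C have "\<forall>\<^sub>F t in at (0::complex). norm (inverse t) \<le> C"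
      by eventually_elim (auto simp: norm_mult norm_divide power2_eq_square field_simps)
    then have "inverse \<in> O[at (0::complex)](\<lambda>_. 1)"
      by (intro bigoI[of _ C]) simp
    moreover have "is_pole inverse (0::complex)"
      using is_pole_inverse[of 0] by (simp add: inverse_eq_divide[abs_def])
    ultimately show False
      using is_pole_not_bigo_1 by blast
  qed
qed (use that in blast)

section \<open>Logarithmic derivatives and the square of the cubic differential\<close>

text \<open>Write \<open>f - c = g * t^k\<close> with \<open>g\<close> analytic and nonzero at 0.
  Then \<open>t\<close> times the logarithmic derivative is \<open>k + t * g' / g\<close>, which is
  analytic whether \<open>f - c\<close> has a zero, a pole or neither.\<close>

lemma log_deriv_bigo:
  fixes f :: "complex \<Rightarrow> complex"
  assumes mero: "f meromorphic_on {0}" and nconst: "\<exists>\<^sub>F t in at 0. f t \<noteq> c"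
  shows "(\<lambda>t. t * deriv f t / (f t - c)) \<in> O[at 0](\<lambda>_. 1)"
proof -
  have "(\<lambda>t. f t - c) meromorphic_on {0}"
    by (intro meromorphic_intros mero)
  then have sing: "isolated_singularity_at (\<lambda>t. f t - c) 0" "not_essential (\<lambda>t. f t - c) 0"
    by (auto simp: meromorphic_at_iff)
  have nz: "\<exists>\<^sub>F t in at 0. f t - c \<noteq> 0"
    using nconst by simp
  define g where "g = zor_poly (\<lambda>t. f t - c) 0"
  define k where "k = zorder (\<lambda>t. f t - c) 0"
  note zorder_exist[OF sing nz, folded g_def k_def]
  then obtain r where "r > 0" and g0: "g 0 \<noteq> 0" and hol: "g holomorphic_on cball 0 r"
    and "\<forall>t\<in>cball 0 r - {0}. f t - c = g t * (t - 0) powi k \<and> g t \<noteq> 0"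
    by blast
  then have fac: "f t - c = g t * t powi k \<and> g t \<noteq> 0" if "t \<in> cball 0 r - {0}" for t
    using that by simp
  have hol': "g holomorphic_on ball 0 r"
    using hol by (rule holomorphic_on_subset) auto
  then have ana: "g analytic_on {0}" "deriv g analytic_on {0}"
    using \<open>r > 0\<close> by (auto simp: analytic_at intro!: holomorphic_deriv exI[of _ "ball 0 r"])
  have eq: "of_int k + t * (deriv g t / g t) = t * deriv f t / (f t - c)"
    if t: "t \<in> ball 0 r - {0}" for t
  proof -
    have "(g has_field_derivative deriv g t) (at t)"
      using hol' t by (auto intro!: holomorphic_derivI)
    then have der: "((\<lambda>s. g s * s powi k + c) has_field_derivative
                 deriv g t * t powi k + g t * (of_int k * t powi (k - 1))) (at t)"
      using t by (auto intro!: derivative_eq_intros)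
    have "\<forall>\<^sub>F s in nhds t. s \<in> ball 0 r - {0}"
      using t by (intro eventually_nhds_in_open) auto
    then have "\<forall>\<^sub>F s in nhds t. f s = g s * s powi k + c"
    proof eventually_elim
      case (elim s)
      then show ?case using fac[of s] by (simp add: algebra_simps)
    qed
    then have "deriv f t = deriv (\<lambda>s. g s * s powi k + c) t"
      by (rule deriv_cong_ev) (rule refl)
    also have "\<dots> = deriv g t * t powi k + g t * (of_int k * t powi (k - 1))"
      using der by (rule DERIV_imp_deriv)
    finally have "deriv f t = deriv g t * t powi k + g t * (of_int k * t powi (k - 1))" .
    moreover have "f t - c = g t * t powi k" "g t \<noteq> 0"
      using fac[of t] t by auto
    moreover have t0: "t \<noteq> 0"
      using t by blast
    moreover have "t powi (k - 1 + 1) = t powi (k - 1) * t"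
      using t0 by (intro power_int_add_1) blast
    then have "t powi k = t * t powi (k - 1)"
      by (simp only: diff_add_cancel mult.commute)
    moreover have "t powi (k - 1) \<noteq> 0"
      using t0 by (intro power_int_not_zero) blast
    \<comment> \<open>With \<open>p\<close> for \<open>t powi (k - 1)\<close>, \<open>x\<close> for
      \<open>k\<close> and \<open>y\<close> for \<open>g t\<close>, this field identity divides the
      product rule by \<open>f t - c\<close>.\<close>
    moreover have "x + t * (g' / y) = t * (g' * (t * p) + y * (x * p)) / (y * (t * p))"
      if "p \<noteq> 0" "y \<noteq> 0" for x g' y p :: complex
    proof -
      have "t * (g' * (t * p) + y * (x * p)) = (t * g' + y * x) * (t * p)"
        by (simp only: distrib_left distrib_right mult_ac)
      then have "t * (g' * (t * p) + y * (x * p)) / (y * (t * p)) = (t * g' + y * x) / y"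
        using that t0 by simp
      then show ?thesis
        using that by (simp add: add_divide_distrib)
    qed
    ultimately show ?thesis
      by metis
  qed
  have "(\<lambda>t. of_int k + t * (deriv g t / g t)) analytic_on {0}"
    using g0 by (intro analytic_intros ana) simp_all
  then have "(\<lambda>t. of_int k + t * (deriv g t / g t)) \<in> O[at 0](\<lambda>_. 1)"
    by (rule analytic_bigo_1)
  also have "?this \<longleftrightarrow> ?thesis"
  proof (rule landau_o.big.in_cong)
    have "\<forall>\<^sub>F t in at 0. t \<in> ball 0 r - {0}"
      using \<open>r > 0\<close> by (intro eventually_at_in_open) auto
    then show "\<forall>\<^sub>F t in at 0. of_int k + t * (deriv g t / g t) = t * deriv f t / (f t - c)"
      by eventually_elim (rule eq)
  qed
  finally show ?thesis .
qed

text \<open>At a pole of \<open>f\<close> two factors pair with logarithmic derivatives, and the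
  inverse of the third is \<open>O(t)\<close>, which makes up for the second factor \<open>t\<close>
  spent. At a finite value at most one of the distinct \<open>a\<close>, \<open>b\<close>,
  \<open>c\<close> is attained; a logarithmic derivative handles that factor, and everything else is
  bounded.\<close>

lemma cubic_differential_bigo:
  fixes f :: "complex \<Rightarrow> complex"
  assumes mero: "f meromorphic_on {0}" and nconst: "\<And>c. \<exists>\<^sub>F t in at 0. f t \<noteq> c"
    and distinct: "a \<noteq> b" "a \<noteq> c" "b \<noteq> c"
  shows "(\<lambda>t. t * (deriv f t)\<^sup>2 / ((f t - a) * (f t - b) * (f t - c))) \<in> O[at 0](\<lambda>_. 1)"
proof (cases "is_pole f 0")
  case True
  have ld: "(\<lambda>t. t * deriv f t / (f t - z)) \<in> O[at 0](\<lambda>_. 1)" for z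
    by (rule log_deriv_bigo[OF mero nconst])
  have "is_pole (\<lambda>t. f t + (- c)) 0"
    using True unfolding is_pole_def by (rule tendsto_add_filterlim_at_infinity'[OF _ tendsto_const])
  moreover have "(\<lambda>t. f t - c) meromorphic_on {0}"
    by (intro meromorphic_intros mero)
  ultimately have "(\<lambda>t. inverse (f t - c)) \<in> O[at 0](\<lambda>t. t)"
    using pole_inverse_bigo[of "\<lambda>t. f t - c"] by simp
  with ld[of a] ld[of b] have "(\<lambda>t. t * deriv f t / (f t - a) * (t * deriv f t / (f t - b)) * inverse (f t - c))
        \<in> O[at 0](\<lambda>t. 1 * 1 * t)"
    by (intro landau_o.big_mult)
  then obtain C where C: "\<forall>\<^sub>F t in at 0.
      norm (t * deriv f t / (f t - a) * (t * deriv f t / (f t - b)) * inverse (f t - c)) \<le> C * norm t"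
    by (auto elim!: landau_o.bigE)
  have "\<forall>\<^sub>F t in at (0::complex). t \<noteq> 0"
    by (simp add: eventually_at_filter)
  with C have "\<forall>\<^sub>F t in at 0. norm (t * (deriv f t)\<^sup>2 / ((f t - a) * (f t - b) * (f t - c))) \<le> C"
  proof eventually_elim
    case (elim t)
    have "t * (t * (deriv f t)\<^sup>2 / ((f t - a) * (f t - b) * (f t - c))) =
      t * deriv f t / (f t - a) * (t * deriv f t / (f t - b)) * inverse (f t - c)"
      by (simp add: divide_inverse power2_eq_square mult_ac)
    then have "norm t * norm (t * (deriv f t)\<^sup>2 / ((f t - a) * (f t - b) * (f t - c))) =
      norm (t * deriv f t / (f t - a) * (t * deriv f t / (f t - b)) * inverse (f t - c))"
      by (metis norm_mult)
    also have "\<dots> \<le> norm t * C"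
      using elim by (simp add: mult.commute)
    finally show ?case
      using elim by simp
  qed
  then show ?thesis
    by (intro bigoI[of _ C]) simp
next
  case False
  then obtain h where h: "h analytic_on {0}" and eq: "\<forall>\<^sub>F t in at 0. f t = h t"
    using meromorphic_extends_if_not_pole[OF mero] by blast
  \<comment> \<open>Agreement on a punctured neighbourhood is agreement near each of its points,
    which is what equality of the derivatives requires.\<close>
  have "\<forall>\<^sub>F t in nhds 0. \<forall>\<^sub>F s in nhds t. s \<noteq> 0 \<longrightarrow> f s = h s"
    using eq by (simp only: eventually_at_filter eventually_eventually) simp
  then have "\<forall>\<^sub>F t in at 0. \<forall>\<^sub>F s in nhds t. s \<noteq> 0 \<longrightarrow> f s = h s"
    by (rule filter_leD[OF at_within_le_nhds])
  moreover have "\<forall>\<^sub>F t in at (0::complex). t \<in> - {0}"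
    by (simp add: eventually_at_filter)
  ultimately have eq': "\<forall>\<^sub>F t in at 0. deriv f t = deriv h t"
  proof eventually_elim
    case (elim t)
    have "\<forall>\<^sub>F s in nhds t. s \<in> - {0}"
      using elim(2) by (intro eventually_nhds_in_open) auto
    with elim(1) have "\<forall>\<^sub>F s in nhds t. f s = h s"
      by eventually_elim simp
    then show ?case
      by (rule deriv_cong_ev) (rule refl)
  qed
  have "deriv h analytic_on {0}"
    using h by (rule analytic_deriv)
  then have dh: "deriv f \<in> O[at 0](\<lambda>_. 1)"
    using analytic_bigo_1 landau_o.big.in_cong[OF eq'] by blast
  have tends: "(f \<longlongrightarrow> h 0) (at 0)"
  proof -
    have "(h \<longlongrightarrow> h 0) (at 0)"
      using analytic_at_imp_isCont[OF h] by (simp add: isCont_def)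
    then show ?thesis
      by (rule Lim_transform_eventually) (use eq in \<open>eventually_elim, simp\<close>)
  qed
  have inv: "(\<lambda>t. inverse (f t - z)) \<in> O[at 0](\<lambda>_. 1)" if "h 0 \<noteq> z" for z
    using that by (intro bigoI_tendsto[where c = "inverse (h 0 - z)"])
      (auto intro!: tendsto_intros tends)
  \<comment> \<open>Only \<open>x\<close> may be the limit of \<open>f\<close>. The cases below put
    the attained root there; their instantiations list \<open>y\<close>, \<open>z\<close>,
    \<open>x\<close> in this order.\<close>
  have key: "(\<lambda>t. t * (deriv f t)\<^sup>2 / ((f t - x) * (f t - y) * (f t - z))) \<in> O[at 0](\<lambda>_. 1)"
    if "h 0 \<noteq> y" "h 0 \<noteq> z" for x y z
  proof -
    have "(\<lambda>t. t * deriv f t / (f t - x)) \<in> O[at 0](\<lambda>_. 1)"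
      by (rule log_deriv_bigo[OF mero nconst])
    with dh inv[OF that(1)] inv[OF that(2)]
    have "(\<lambda>t. t * deriv f t / (f t - x) * (deriv f t * (inverse (f t - y) * inverse (f t - z))))
        \<in> O[at 0](\<lambda>t. 1 * (1 * (1 * 1)))"
      by (intro landau_o.big_mult)
    then show ?thesis
      by (simp add: divide_inverse power2_eq_square mult_ac)
  qed
  show ?thesis
  proof (cases "h 0 = a")
    case True
    then show ?thesis using key[of b c a] distinct by simp
  next
    case False
    then show ?thesis
    proof (cases "h 0 = b")
      case True
      then show ?thesis using key[of a c b] distinct by (simp add: mult_ac)
    next
      case b: False
      then show ?thesis using key[of a b c] False by (simp add: mult_ac)
    qed
  qed
qed

section \<open>Rational functions evaluated along parameters\<close>

text \<open>\<open>eval_fract\<close> uses the reduced fraction. If its denominator vanished at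
  \<open>z\<close>, cross-multiplication with \<open>a / b\<close> would make its numerator vanish
  there too, since \<open>b\<close> does not; this contradicts coprimality.\<close>

lemma eval_fract_divide:
  assumes "poly b z \<noteq> 0"
  shows "eval_fract (to_fract a / to_fract b) z = poly a z / poly b z"
proof -
  define u where "u = to_fract a / to_fract b"
  have b: "b \<noteq> 0"
    using assms by auto
  have "to_fract (fst (quot_of_fract u)) / to_fract (snd (quot_of_fract u)) = to_fract a / to_fract b"
    by (simp only: Fract_conv_to_fract[symmetric] Fract_quot_of_fract u_def)
  then have "to_fract (fst (quot_of_fract u) * b) = to_fract (a * snd (quot_of_fract u))"
    using b by (simp add: field_simps)
  then have cross: "fst (quot_of_fract u) * b = a * snd (quot_of_fract u)"
    by (simp only: to_fract_eq_iff)
  have "coprime (fst (quot_of_fract u)) (snd (quot_of_fract u))"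
    by (rule coprime_quot_of_fract)
  then have "poly (fst (quot_of_fract u)) z \<noteq> 0 \<or> poly (snd (quot_of_fract u)) z \<noteq> 0"
    by (rule coprime_poly_0)
  moreover have "poly (fst (quot_of_fract u)) z * poly b z = poly a z * poly (snd (quot_of_fract u)) z"
    using arg_cong[OF cross, of "\<lambda>p. poly p z"] by simp
  ultimately have "eval_fract u z = poly a z / poly b z"
    using assms by (auto simp: eval_fract_def field_simps)
  then show ?thesis
    by (simp add: u_def)
qed

text \<open>A nonconstant meromorphic function omits any given value on some punctured
  neighbourhood, and \<open>p\<close> has finitely many roots.\<close>

lemma eventually_poly_nonzero:
  fixes f :: "complex \<Rightarrow> complex"
  assumes "f meromorphic_on {0}" "\<And>c. \<not> (\<forall>\<^sub>F t in at 0. f t = c)" "p \<noteq> 0"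
  shows "\<forall>\<^sub>F t in at 0. poly p (f t) \<noteq> 0"
proof -
  have "\<forall>\<^sub>F t in at 0. f t \<noteq> c" for c
  proof -
    have "(\<lambda>t. f t - c) meromorphic_on {0}"
      by (intro meromorphic_intros assms)
    then have "isolated_singularity_at (\<lambda>t. f t - c) 0" "not_essential (\<lambda>t. f t - c) 0"
      by (auto simp: meromorphic_at_iff)
    moreover have "\<exists>\<^sub>F t in at 0. f t - c \<noteq> 0"
      using assms(2)[of c] by (simp add: frequently_def)
    ultimately have "\<forall>\<^sub>F t in at 0. f t - c \<noteq> 0 \<and> t \<in> UNIV"
      using non_zero_neighbour[of "\<lambda>t. f t - c" 0] by simp
    then show ?thesis by simp
  qed
  moreover have "finite {c. poly p c = 0}"
    using assms(3) by (rule poly_roots_finite)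
  ultimately have "\<forall>\<^sub>F t in at 0. \<forall>c\<in>{c. poly p c = 0}. f t \<noteq> c"
    by (intro eventually_ball_finite) blast+
  then show ?thesis
    by eventually_elim auto
qed

lemma square_shift_nonconst: "\<not> (\<forall>\<^sub>F t in at 0. z + t\<^sup>2 = c)" for z c :: complex
proof
  assume ev: "\<forall>\<^sub>F t in at 0. z + t\<^sup>2 = c"
  have "((\<lambda>t. z + t\<^sup>2) \<longlongrightarrow> z + 0\<^sup>2) (at 0)"
    by (intro tendsto_intros)
  then have "((\<lambda>_::complex. c) \<longlongrightarrow> z) (at 0)"
    using Lim_transform_eventually[OF _ ev] by simp
  then have "c = z"
    by (simp add: tendsto_const_iff)
  moreover have "\<forall>\<^sub>F t in at (0::complex). t \<noteq> 0"
    by (simp add: eventually_at_filter)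
  with ev have "\<forall>\<^sub>F t in at (0::complex). z \<noteq> c"
    by eventually_elim auto
  ultimately show False by simp
qed

lemma is_pole_inverse_square: "is_pole (\<lambda>t. inverse (t\<^sup>2)) (0::complex)"
  using is_pole_inverse_power[of 2 0] by (simp add: inverse_eq_divide)

text \<open>A pole of \<open>u\<close> of order m at \<open>z\<close> has order 2m \<ge> 2 along
  \<open>z + t^2\<close>, too much for one factor \<open>t\<close> to absorb. So \<open>u\<close> is
  a polynomial, and boundedness at infinity makes it constant.\<close>

lemma fract_const_if_bounded:
  fixes u :: "complex poly fract"
  assumes fin: "\<And>z. (\<lambda>t. t * eval_fract u (z + t\<^sup>2)) \<in> O[at 0](\<lambda>_. 1)"
    and inf: "(\<lambda>t. eval_fract u (inverse (t\<^sup>2))) \<in> O[at 0](\<lambda>_. 1)"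
  obtains c where "u = to_fract [:c:]"
proof -
  define N W where "N = fst (quot_of_fract u)" and "W = snd (quot_of_fract u)"
  have u: "u = to_fract N / to_fract W"
    by (simp only: Fract_conv_to_fract[symmetric] Fract_quot_of_fract N_def W_def)
  have eval: "eval_fract u z = poly N z / poly W z" for z
    by (simp add: eval_fract_def N_def W_def)
  have coprime: "coprime N W"
    unfolding N_def W_def by (rule coprime_quot_of_fract)
  have "W \<noteq> 0"
    by (simp add: W_def)
  have "poly W z \<noteq> 0" for z
  proof
    assume z: "poly W z = 0"
    then obtain V where V: "W = [:- z, 1:] * V"
      by (auto simp: poly_eq_0_iff_dvd elim: dvdE)
    with \<open>W \<noteq> 0\<close> have "V \<noteq> 0" by auto
    have nz: "\<forall>\<^sub>F t in at 0. poly V (z + t\<^sup>2) \<noteq> 0"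
    proof (rule eventually_poly_nonzero[OF _ _ \<open>V \<noteq> 0\<close>])
      show "(\<lambda>t. z + t\<^sup>2) meromorphic_on {0}"
        by (intro meromorphic_intros)
      show "\<not> (\<forall>\<^sub>F t in at 0. z + t\<^sup>2 = c)" for c :: complex
        by (rule square_shift_nonconst)
    qed
    obtain C where C: "\<forall>\<^sub>F t in at 0. norm (t * eval_fract u (z + t\<^sup>2)) \<le> C"
      using fin[of z] by (auto elim!: landau_o.bigE)
    have "\<forall>\<^sub>F t in at (0::complex). t \<noteq> 0"
      by (simp add: eventually_at_filter)
    \<comment> \<open>Since \<open>W\<close> equals \<open>t^2 * V\<close> along the parameter, a
      factor \<open>t\<close> is left on the right, and the limit forces \<open>N\<close> to vanish
      at \<open>z\<close> together with \<open>W\<close>.\<close>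
    with C nz have "\<forall>\<^sub>F t in at 0. norm (poly N (z + t\<^sup>2)) \<le> C * norm (t * poly V (z + t\<^sup>2))"
      by eventually_elim (simp add: eval V norm_mult norm_divide norm_power power2_eq_square field_simps)
    moreover have "((\<lambda>t. norm (poly N (z + t\<^sup>2))) \<longlongrightarrow> norm (poly N (z + 0\<^sup>2))) (at 0)"
      by (intro tendsto_intros)
    moreover have "((\<lambda>t. C * norm (t * poly V (z + t\<^sup>2))) \<longlongrightarrow> C * norm (0 * poly V (z + 0\<^sup>2))) (at 0)"
      by (intro tendsto_intros)
    ultimately have "norm (poly N (z + 0\<^sup>2)) \<le> C * norm (0 * poly V (z + 0\<^sup>2))"
      by (intro tendsto_le[OF at_neq_bot])
    then have "poly N z = 0" by simp
    with z coprime_poly_0[OF coprime] show False by blast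
  qed
  then have "constant (poly W)"
    using fundamental_theorem_of_algebra by blast
  then obtain w where w: "W = [:w:]"
    using constant_degree degree_eq_zeroE by blast
  with \<open>W \<noteq> 0\<close> have "w \<noteq> 0" by simp
  have "degree N = 0"
  proof (rule ccontr)
    assume deg: "degree N \<noteq> 0"
    have "filterlim (\<lambda>t. poly N (inverse (t\<^sup>2))) at_infinity (at (0::complex))"
      using filterlim_compose[OF filterlim_poly_at_infinity is_pole_inverse_square[unfolded is_pole_def]]
        deg by blast
    moreover have "(\<lambda>t. w * eval_fract u (inverse (t\<^sup>2))) \<in> O[at 0](\<lambda>_. 1)"
      using inf by simp
    ultimately show False
      using is_pole_not_bigo_1[of "\<lambda>t. poly N (inverse (t\<^sup>2))" 0] w \<open>w \<noteq> 0\<close>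
      by (simp add: eval is_pole_def)
  qed
  then obtain n where "N = [:n:]"
    by (rule degree_eq_zeroE)
  with w \<open>w \<noteq> 0\<close> have "N = [:n / w:] * W"
    by simp
  then have "to_fract N = to_fract [:n / w:] * to_fract W"
    by (simp only: to_fract_mult)
  then have "u = to_fract [:n / w:]"
    using \<open>W \<noteq> 0\<close> unfolding u by simp
  then show ?thesis by (rule that)
qed

section \<open>The curves and their local parameters\<close>

text \<open>The entries of a potential have at most a simple pole at 0, which the factor
  \<open>l\<close> clears. \<open>p\<close> collects a square factor, lost in the normalization;
  \<open>D\<close> may itself contain further squares.\<close>

definition hyperelliptic_curve :: "complex poly \<Rightarrow> complex poly \<Rightarrow> (complex \<times> complex) set" where
  "hyperelliptic_curve D p = {(n, l). l \<noteq> 0 \<and> (l * n)\<^sup>2 = poly D l * (poly p l)\<^sup>2}"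

lemma meromorphic_on_poly [meromorphic_intros]:
  fixes f :: "complex \<Rightarrow> complex"
  assumes "f meromorphic_on A"
  shows "(\<lambda>t. poly p (f t)) meromorphic_on A"
  by (induction p) (auto intro!: meromorphic_intros assms)

lemma analytic_on_poly [analytic_intros]:
  fixes f :: "complex \<Rightarrow> complex"
  assumes "f analytic_on A"
  shows "(\<lambda>t. poly p (f t)) analytic_on A"
  by (induction p) (auto intro!: analytic_intros assms)

text \<open>Dividing by the value at \<open>z\<close> moves the argument of \<open>csqrt\<close>
  close to 1, away from the branch cut; the prefactor restores the constant.\<close>

lemma poly_local_sqrt:
  assumes "poly h z \<noteq> (0::complex)"
  obtains g where "g analytic_on {0}" "\<And>t. (g t)\<^sup>2 = poly h (z + t\<^sup>2)"
proof
  define g where "g = (\<lambda>t. csqrt (poly h z) * csqrt (poly h (z + t\<^sup>2) / poly h z))"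
  show "g analytic_on {0}"
    unfolding g_def using assms by (intro analytic_intros) auto
  show "(g t)\<^sup>2 = poly h (z + t\<^sup>2)" for t
    using assms by (simp add: g_def power_mult_distrib)
qed

lemma deriv_square_shift: "deriv (\<lambda>t. z + t\<^sup>2) t = 2 * t" for z t :: complex
  by (rule DERIV_imp_deriv) (auto intro!: derivative_eq_intros)

lemma deriv_inverse_square: "deriv (\<lambda>t. inverse (t\<^sup>2)) t = - 2 * inverse t ^ 3"
  if "t \<noteq> 0" for t :: complex
  by (rule DERIV_imp_deriv)
    (use that in \<open>auto intro!: derivative_eq_intros simp: field_simps eval_nat_numeral\<close>)

lemma eventually_at_0_nonzero: "\<forall>\<^sub>F t in at 0. t \<noteq> (0::complex)"
  by (simp add: eventually_at_filter)

text \<open>Substituting \<open>l = z + t^2\<close> turns \<open>(l - z)^m\<close> into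
  \<open>t^(2 * m)\<close>, so \<open>D\<close> acquires a square root along the parameter whether
  or not \<open>z\<close> is a branch point.\<close>

lemma branch_param_shift:
  assumes "D \<noteq> 0"
  obtains n where "branch_param (hyperelliptic_curve D p) n (\<lambda>t. z + t\<^sup>2)"
proof -
  obtain h where h: "D = [:- z, 1:] ^ order z D * h" "\<not> [:- z, 1:] dvd h"
    using order_decomp[OF assms] by blast
  then have "poly h z \<noteq> 0"
    by (simp add: poly_eq_0_iff_dvd)
  then obtain g where g: "g analytic_on {0}" "\<And>t. (g t)\<^sup>2 = poly h (z + t\<^sup>2)"
    by (rule poly_local_sqrt) blast
  define m where "m = order z D"
  have D: "poly D (z + t\<^sup>2) = (t ^ m * g t)\<^sup>2" for t
  proof -
    have "poly D (z + t\<^sup>2) = (t\<^sup>2) ^ m * poly h (z + t\<^sup>2)"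
      by (subst h(1)) (simp add: m_def)
    then show ?thesis
      by (simp add: g(2) power_mult_distrib power_mult[symmetric] mult.commute)
  qed
  define n where "n = (\<lambda>t. t ^ m * g t * poly p (z + t\<^sup>2) / (z + t\<^sup>2))"
  have l: "(\<lambda>t. z + t\<^sup>2) meromorphic_on {0}"
    by (intro meromorphic_intros)
  have "n meromorphic_on {0}"
    unfolding n_def by (intro meromorphic_intros analytic_on_imp_meromorphic_on g)
  moreover have "\<forall>\<^sub>F t in at 0. poly [:0, 1:] (z + t\<^sup>2) \<noteq> 0"
    by (rule eventually_poly_nonzero[OF l square_shift_nonconst]) simp
  then have "\<forall>\<^sub>F t in at 0. (n t, z + t\<^sup>2) \<in> hyperelliptic_curve D p"
  proof eventually_elim
    case (elim t)
    then have "(z + t\<^sup>2) * n t = t ^ m * g t * poly p (z + t\<^sup>2)"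
      by (simp add: n_def)
    then have "((z + t\<^sup>2) * n t)\<^sup>2 = poly D (z + t\<^sup>2) * (poly p (z + t\<^sup>2))\<^sup>2"
      by (simp only: D power_mult_distrib)
    then show ?case
      using elim by (simp add: hyperelliptic_curve_def)
  qed
  ultimately have "branch_param (hyperelliptic_curve D p) n (\<lambda>t. z + t\<^sup>2)"
    using l square_shift_nonconst by (simp add: branch_param_def)
  then show ?thesis by (rule that)
qed

text \<open>At \<open>l = 1 / t^2\<close> the polynomial \<open>D\<close> is an even power of
  \<open>1 / t\<close> times the reflected polynomial at \<open>t^2\<close>, which is nonzero at
  \<open>t = 0\<close>. So a square root exists whatever the parity of the degree.\<close>

lemma branch_param_infinity:
  assumes "D \<noteq> 0"
  obtains n where "branch_param (hyperelliptic_curve D p) n (\<lambda>t. inverse (t\<^sup>2))"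
proof -
  have "poly (reflect_poly D) 0 \<noteq> 0"
    using assms by simp
  then obtain g where g: "g analytic_on {0}" "\<And>t. (g t)\<^sup>2 = poly (reflect_poly D) (0 + t\<^sup>2)"
    by (rule poly_local_sqrt) blast
  define m where "m = degree D"
  have D: "poly D (inverse (t\<^sup>2)) = (g t / t ^ m)\<^sup>2" if "t \<noteq> 0" for t
    using that
    by (simp add: g(2) poly_reflect_poly_nz m_def power_divide power_mult[symmetric] mult.commute)
  define n where "n = (\<lambda>t. g t / t ^ m * poly p (inverse (t\<^sup>2)) * t\<^sup>2)"
  have l: "(\<lambda>t::complex. inverse (t\<^sup>2)) meromorphic_on {0}"
    by (intro meromorphic_intros)
  have "n meromorphic_on {0}"
    unfolding n_def by (intro meromorphic_intros analytic_on_imp_meromorphic_on g)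
  moreover have "\<forall>\<^sub>F t in at 0. (n t, inverse (t\<^sup>2)) \<in> hyperelliptic_curve D p"
    using eventually_at_0_nonzero
  proof eventually_elim
    case (elim t)
    then have "inverse (t\<^sup>2) * n t = g t / t ^ m * poly p (inverse (t\<^sup>2))"
      by (simp add: n_def)
    then have "(inverse (t\<^sup>2) * n t)\<^sup>2 = poly D (inverse (t\<^sup>2)) * (poly p (inverse (t\<^sup>2)))\<^sup>2"
      by (simp only: D[OF elim] power_mult_distrib)
    then show ?case
      using elim by (simp add: hyperelliptic_curve_def)
  qed
  moreover have "\<not> (\<forall>\<^sub>F t in at (0::complex). inverse (t\<^sup>2) = c)" for c
  proof
    assume ev: "\<forall>\<^sub>F t in at (0::complex). inverse (t\<^sup>2) = c"
    have "(\<lambda>t::complex. inverse (t\<^sup>2)) \<in> O[at 0](\<lambda>_. 1)"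
      by (intro bigoI[of _ "norm c"]) (use ev in \<open>eventually_elim, simp\<close>)
    then show False
      using is_pole_not_bigo_1 is_pole_inverse_square by blast
  qed
  ultimately have "branch_param (hyperelliptic_curve D p) n (\<lambda>t. inverse (t\<^sup>2))"
    using l by (simp add: branch_param_def)
  then show ?thesis by (rule that)
qed

section \<open>Holomorphic differentials on the curves\<close>

text \<open>The sheet exchange \<open>\<nu> \<mapsto> -\<nu>\<close> separates the two summands.\<close>

lemma holomorphic_differential_parts_bigo:
  assumes uv: "(u, v) \<in> holomorphic_differentials (hyperelliptic_curve D p)"
    and param: "branch_param (hyperelliptic_curve D p) n l"
  shows "(\<lambda>t. eval_fract u (l t) * deriv l t) \<in> O[at 0](\<lambda>_. 1)"
    and "(\<lambda>t. eval_fract v (l t) * n t * deriv l t) \<in> O[at 0](\<lambda>_. 1)"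
proof -
  have bound: "(\<lambda>t. (eval_fract u (l t) + eval_fract v (l t) * m t) * deriv l t) \<in> O[at 0](\<lambda>_. 1)"
    if "branch_param (hyperelliptic_curve D p) m l" for m
  proof -
    from uv that obtain h where "h analytic_on {0}"
      and eq: "\<forall>\<^sub>F t in at 0. (eval_fract u (l t) + eval_fract v (l t) * m t) * deriv l t = h t"
      unfolding holomorphic_differentials_def by blast
    then have "h \<in> O[at 0](\<lambda>_. 1)"
      by (intro analytic_bigo_1)
    then show ?thesis
      using landau_o.big.in_cong[OF eq] by blast
  qed
  have "branch_param (hyperelliptic_curve D p) (\<lambda>t. - n t) l"
    using param by (auto simp: branch_param_def hyperelliptic_curve_def intro!: meromorphic_intros)
  note bounds = bound[OF param] bound[OF this]
  have "(\<lambda>t. 1 / 2 * ((eval_fract u (l t) + eval_fract v (l t) * n t) * deriv l t +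
      (eval_fract u (l t) + eval_fract v (l t) * - n t) * deriv l t)) \<in> O[at 0](\<lambda>_. 1)"
    by (intro landau_o.big.cmult_in_iff[THEN iffD2] sum_in_bigo bounds) simp
  then show "(\<lambda>t. eval_fract u (l t) * deriv l t) \<in> O[at 0](\<lambda>_. 1)"
    by (simp add: algebra_simps)
  have "(\<lambda>t. 1 / 2 * ((eval_fract u (l t) + eval_fract v (l t) * n t) * deriv l t -
      (eval_fract u (l t) + eval_fract v (l t) * - n t) * deriv l t)) \<in> O[at 0](\<lambda>_. 1)"
    by (intro landau_o.big.cmult_in_iff[THEN iffD2] sum_in_bigo bounds) simp
  then show "(\<lambda>t. eval_fract v (l t) * n t * deriv l t) \<in> O[at 0](\<lambda>_. 1)"
    by (simp add: algebra_simps)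
qed

text \<open>The curve equation relates only squares of pullbacks; this passes back to the pullbacks
  without choosing a square root of \<open>D\<close>.\<close>

lemma square_bigo_1_iff:
  fixes f :: "complex \<Rightarrow> complex"
  shows "(\<lambda>t. (f t)\<^sup>2) \<in> O[F](\<lambda>_. 1) \<longleftrightarrow> f \<in> O[F](\<lambda>_. 1)"
proof
  assume "(\<lambda>t. (f t)\<^sup>2) \<in> O[F](\<lambda>_. 1)"
  then obtain C where "\<forall>\<^sub>F t in F. (norm (f t))\<^sup>2 \<le> C"
    by (auto elim!: landau_o.bigE simp: norm_power)
  then have "\<forall>\<^sub>F t in F. norm (f t) \<le> sqrt C"
    by eventually_elim (rule real_le_rsqrt)
  then show "f \<in> O[F](\<lambda>_. 1)"
    by (intro bigoI[of _ "sqrt C"]) simp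
next
  assume "f \<in> O[F](\<lambda>_. 1)"
  from landau_o.big_power[OF this, of 2] show "(\<lambda>t. (f t)\<^sup>2) \<in> O[F](\<lambda>_. 1)"
    by simp
qed

text \<open>The sphere carries no nonzero holomorphic differential. Along \<open>z + t^2\<close> the
  derivative is \<open>2 * t\<close>, so \<open>t * u\<close> is bounded and \<open>u\<close> has no
  finite pole; along \<open>1 / t^2\<close> it is \<open>-2 / t^3\<close>, so \<open>u\<close>
  vanishes at infinity.\<close>

lemma holomorphic_differential_even_part_eq_0:
  assumes D: "D \<noteq> 0" and uv: "(u, v) \<in> holomorphic_differentials (hyperelliptic_curve D p)"
  shows "u = 0"
proof -
  have fin: "(\<lambda>t. t * eval_fract u (z + t\<^sup>2)) \<in> O[at 0](\<lambda>_. 1)" for z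
  proof -
    obtain n where "branch_param (hyperelliptic_curve D p) n (\<lambda>t. z + t\<^sup>2)"
      using D by (rule branch_param_shift)
    from holomorphic_differential_parts_bigo(1)[OF uv this]
    have "(\<lambda>t. 1 / 2 * (eval_fract u (z + t\<^sup>2) * deriv (\<lambda>t. z + t\<^sup>2) t)) \<in> O[at 0](\<lambda>_. 1)"
      by (subst landau_o.big.cmult_in_iff) simp_all
    then show ?thesis
      by (simp add: deriv_square_shift mult.commute)
  qed
  have inf: "(\<lambda>t. eval_fract u (inverse (t\<^sup>2))) \<in> O[at 0](\<lambda>t. t)"
  proof -
    obtain n where "branch_param (hyperelliptic_curve D p) n (\<lambda>t. inverse (t\<^sup>2))"
      using D by (rule branch_param_infinity)
    from holomorphic_differential_parts_bigo(1)[OF uv this]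
    have "(\<lambda>t. eval_fract u (inverse (t\<^sup>2)) * deriv (\<lambda>t. inverse (t\<^sup>2)) t) \<in> O[at 0](\<lambda>_. 1)" .
    \<comment> \<open>The factor \<open>- 1 / 2 * t^2 * t\<close> inverts the derivative
      \<open>-2 / t^3\<close>. Only its last \<open>t\<close> is kept as a rate, since
      \<open>O(t)\<close> already gives vanishing at infinity.\<close>
    moreover have "(\<lambda>t::complex. - 1 / 2 * t\<^sup>2) \<in> O[at 0](\<lambda>_. 1)"
      by (intro analytic_bigo_1 analytic_intros)
    moreover have "(\<lambda>t::complex. t) \<in> O[at 0](\<lambda>t. t)"
      by simp
    ultimately have "(\<lambda>t. eval_fract u (inverse (t\<^sup>2)) * deriv (\<lambda>t. inverse (t\<^sup>2)) t * (- 1 / 2 * t\<^sup>2 * t))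
        \<in> O[at 0](\<lambda>t. 1 * (1 * t))"
      by (intro landau_o.big_mult)
    also have "?this \<longleftrightarrow> (\<lambda>t. eval_fract u (inverse (t\<^sup>2))) \<in> O[at 0](\<lambda>t. 1 * (1 * t))"
    proof (rule landau_o.big.in_cong)
      show "\<forall>\<^sub>F t in at 0. eval_fract u (inverse (t\<^sup>2)) * deriv (\<lambda>t. inverse (t\<^sup>2)) t *
          (- 1 / 2 * t\<^sup>2 * t) = eval_fract u (inverse (t\<^sup>2))"
        using eventually_at_0_nonzero
      proof eventually_elim
        case (elim t)
        then have "deriv (\<lambda>t. inverse (t\<^sup>2)) t * (- 1 / 2 * t\<^sup>2 * t) = 1"
          unfolding deriv_inverse_square[OF elim] by (simp add: field_simps eval_nat_numeral)
        then show ?case by (simp only: mult.assoc) simp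
      qed
    qed
    finally show ?thesis by simp
  qed
  have id_1: "(\<lambda>t::complex. t) \<in> O[at 0](\<lambda>_. 1)"
    by (intro analytic_bigo_1 analytic_intros)
  have "(\<lambda>t. eval_fract u (inverse (t\<^sup>2))) \<in> O[at 0](\<lambda>_. 1)"
    by (rule landau_o.big_trans[OF inf id_1])
  with fin obtain c where c: "u = to_fract [:c:]"
    by (rule fract_const_if_bounded)
  have "eval_fract u z = c" for z
    by (simp add: c eval_fract_def)
  with inf have "(\<lambda>_::complex. c) \<in> O[at 0](\<lambda>t. t)"
    by simp
  then obtain C where C: "\<forall>\<^sub>F t in at (0::complex). norm c \<le> C * norm t"
    by (auto elim!: landau_o.bigE)
  have "((\<lambda>t::complex. C * norm t) \<longlongrightarrow> C * norm (0::complex)) (at 0)"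
    by (intro tendsto_intros)
  then have "norm c \<le> C * norm (0::complex)"
    by (rule tendsto_lowerbound[OF _ C]) simp
  then show ?thesis
    by (simp add: c)
qed

text \<open>Put \<open>r = v D p / l\<close>. The curve equation gives
  \<open>(r dl)^2 = D (v n dl)^2\<close>. Over finite points \<open>D\<close> is bounded, hence so
  is \<open>t * r\<close>. At infinity \<open>D\<close> grows at most like \<open>t^-6\<close>, by
  the degree bound, and this matches \<open>dl^2 = 4 t^-6 dt^2\<close>. So \<open>r\<close> is
  constant.\<close>

lemma holomorphic_differential_odd_part:
  assumes D: "D \<noteq> 0" and p: "p \<noteq> 0" and deg: "degree D \<le> 3"
    and uv: "(u, v) \<in> holomorphic_differentials (hyperelliptic_curve D p)"
  obtains c where "v = to_fract [:c:] * (to_fract [:0, 1:] / to_fract (D * p))"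
proof -
  define N W where "N = fst (quot_of_fract v)" and "W = snd (quot_of_fract v)"
  have v: "v = to_fract N / to_fract W"
    by (simp only: Fract_conv_to_fract[symmetric] Fract_quot_of_fract N_def W_def)
  have "W \<noteq> 0"
    by (simp add: W_def)
  define r where "r = to_fract (N * (D * p)) / to_fract (W * [:0, 1:])"
  have r: "\<forall>\<^sub>F t in at 0. (eval_fract r (l t) * deriv l t)\<^sup>2 =
      poly D (l t) * (eval_fract v (l t) * n t * deriv l t)\<^sup>2"
    if param: "branch_param (hyperelliptic_curve D p) n l" for n l
  proof -
    have "W * [:0, 1:] \<noteq> 0"
      using \<open>W \<noteq> 0\<close> by simp
    then have "\<forall>\<^sub>F t in at 0. poly (W * [:0, 1:]) (l t) \<noteq> 0"
      by (intro eventually_poly_nonzero) (use param in \<open>auto simp: branch_param_def\<close>)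
    moreover have "\<forall>\<^sub>F t in at 0. (n t, l t) \<in> hyperelliptic_curve D p"
      using param by (simp add: branch_param_def)
    ultimately show ?thesis
    proof eventually_elim
      case (elim t)
      have l: "l t \<noteq> 0" and n: "(l t * n t)\<^sup>2 = poly D (l t) * (poly p (l t))\<^sup>2"
        using elim(2) by (auto simp: hyperelliptic_curve_def)
      have "eval_fract r (l t) = poly (N * (D * p)) (l t) / poly (W * [:0, 1:]) (l t)"
        unfolding r_def using elim(1) by (rule eval_fract_divide)
      then have "eval_fract r (l t) * l t = eval_fract v (l t) * poly D (l t) * poly p (l t)"
        using l by (simp add: eval_fract_def N_def W_def)
      then have "(eval_fract r (l t) * l t)\<^sup>2 = (eval_fract v (l t))\<^sup>2 * poly D (l t) * (l t * n t)\<^sup>2"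
        unfolding n by (simp add: power_mult_distrib power2_eq_square)
      then have "(l t)\<^sup>2 * (eval_fract r (l t))\<^sup>2 = (l t)\<^sup>2 * (poly D (l t) * (eval_fract v (l t) * n t)\<^sup>2)"
        by (simp only: power_mult_distrib mult_ac)
      then show ?case
        using l by (simp add: power_mult_distrib)
    qed
  qed
  have fin: "(\<lambda>t. t * eval_fract r (z + t\<^sup>2)) \<in> O[at 0](\<lambda>_. 1)" for z
  proof -
    obtain n where param: "branch_param (hyperelliptic_curve D p) n (\<lambda>t. z + t\<^sup>2)"
      using D by (rule branch_param_shift)
    let ?g = "\<lambda>t. eval_fract v (z + t\<^sup>2) * n t * deriv (\<lambda>t. z + t\<^sup>2) t"
    have "(\<lambda>t. (?g t)\<^sup>2) \<in> O[at 0](\<lambda>_. 1)"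
      unfolding square_bigo_1_iff by (rule holomorphic_differential_parts_bigo(2)[OF uv param])
    moreover have "(\<lambda>t. poly D (z + t\<^sup>2)) \<in> O[at 0](\<lambda>_. 1)"
      by (intro analytic_bigo_1 analytic_intros)
    ultimately have "(\<lambda>t. poly D (z + t\<^sup>2) * (?g t)\<^sup>2) \<in> O[at 0](\<lambda>_. 1 * 1)"
      by (intro landau_o.big_mult)
    then have "(\<lambda>t. (eval_fract r (z + t\<^sup>2) * deriv (\<lambda>t. z + t\<^sup>2) t)\<^sup>2) \<in> O[at 0](\<lambda>_. 1)"
      using landau_o.big.in_cong[OF r[OF param]] by simp
    then have "(\<lambda>t. 1 / 2 * (eval_fract r (z + t\<^sup>2) * deriv (\<lambda>t. z + t\<^sup>2) t)) \<in> O[at 0](\<lambda>_. 1)"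
      unfolding square_bigo_1_iff by (subst landau_o.big.cmult_in_iff) simp_all
    then show ?thesis
      by (simp add: deriv_square_shift mult.commute)
  qed
  have inf: "(\<lambda>t. eval_fract r (inverse (t\<^sup>2))) \<in> O[at 0](\<lambda>_. 1)"
  proof -
    let ?l = "\<lambda>t::complex. inverse (t\<^sup>2)"
    obtain n where param: "branch_param (hyperelliptic_curve D p) n ?l"
      using D by (rule branch_param_infinity)
    let ?g = "\<lambda>t. eval_fract v (?l t) * n t * deriv ?l t"
    have "(\<lambda>t. (?g t)\<^sup>2) \<in> O[at 0](\<lambda>_. 1)"
      unfolding square_bigo_1_iff by (rule holomorphic_differential_parts_bigo(2)[OF uv param])
    \<comment> \<open>\<open>q\<close> is \<open>D (1 / t^2)\<close> times \<open>t^6 / 4\<close>,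
      the inverse of the squared derivative. The reflected polynomial makes it visibly analytic at
      0; \<open>degree D \<le> 3\<close> makes the natural number \<open>3 - degree D\<close> a true
      difference.\<close>
    moreover define q where "q = (\<lambda>t. 1 / 4 * t ^ (2 * (3 - degree D)) * poly (reflect_poly D) (t\<^sup>2))"
    have "q \<in> O[at 0](\<lambda>_. 1)"
      unfolding q_def by (intro analytic_bigo_1 analytic_intros)
    ultimately have "(\<lambda>t. q t * (?g t)\<^sup>2) \<in> O[at 0](\<lambda>_. 1 * 1)"
      by (intro landau_o.big_mult)
    also have "?this \<longleftrightarrow> (\<lambda>t. (eval_fract r (?l t))\<^sup>2) \<in> O[at 0](\<lambda>_. 1 * 1)"
    proof (rule landau_o.big.in_cong)
      show "\<forall>\<^sub>F t in at 0. q t * (?g t)\<^sup>2 = (eval_fract r (?l t))\<^sup>2"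
        using r[OF param] eventually_at_0_nonzero
      proof eventually_elim
        case (elim t)
        have "q t = 1 / 4 * t ^ (2 * (3 - degree D)) * ((t\<^sup>2) ^ degree D * poly D (?l t))"
          using elim(2) by (simp add: q_def poly_reflect_poly_nz)
        also have "\<dots> = 1 / 4 * (t ^ (2 * (3 - degree D)) * t ^ (2 * degree D)) * poly D (?l t)"
          by (simp only: power_mult[of t 2 "degree D", symmetric] mult.assoc)
        also have "t ^ (2 * (3 - degree D)) * t ^ (2 * degree D) = t ^ 6"
        proof -
          have "2 * (3 - degree D) + 2 * degree D = 6"
            using deg by linarith
          then show ?thesis by (simp only: power_add[symmetric])
        qed
        finally have "q t * (?g t)\<^sup>2 = 1 / 4 * t ^ 6 * (poly D (?l t) * (?g t)\<^sup>2)"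
          by (simp only: mult.assoc)
        also have "\<dots> = (eval_fract r (?l t))\<^sup>2 * (1 / 4 * t ^ 6 * (deriv ?l t)\<^sup>2)"
          unfolding elim(1)[symmetric] by (simp only: power_mult_distrib mult_ac)
        also have "1 / 4 * t ^ 6 * (deriv ?l t)\<^sup>2 = 1"
          unfolding deriv_inverse_square[OF elim(2)]
          using elim(2) by (simp add: field_simps eval_nat_numeral)
        finally show ?case by simp
      qed
    qed
    finally show ?thesis
      by (simp add: square_bigo_1_iff)
  qed
  obtain c where c: "r = to_fract [:c:]"
    using fin inf by (rule fract_const_if_bounded)
  have nz: "to_fract (D * p) \<noteq> 0" "to_fract [:0, 1::complex:] \<noteq> 0" "to_fract W \<noteq> 0"
    using D p \<open>W \<noteq> 0\<close> by simp_all
  have "to_fract (N * (D * p)) = to_fract [:c:] * to_fract (W * [:0, 1:])"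
    using c \<open>W \<noteq> 0\<close> unfolding r_def by (subst (asm) divide_eq_eq) simp_all
  then have "to_fract N * to_fract (D * p) = to_fract [:c:] * (to_fract W * to_fract [:0, 1:])"
    by (simp only: to_fract_mult)
  then have "v = to_fract [:c:] * (to_fract [:0, 1:] / to_fract (D * p))"
    using nz unfolding v by (simp only: divide_eq_eq eq_divide_eq times_divide_eq_right mult_ac) simp
  then show ?thesis by (rule that)
qed

text \<open>The pullback \<open>g\<close> of \<open>l n dl / (D p)\<close> satisfies
  \<open>g^2 = l'^2 / D(l)\<close>, because \<open>(l n)^2 = D p^2\<close>. Three distinct roots
  bound \<open>t * g^2\<close>, and parity then excludes a pole of \<open>g\<close>.\<close>

lemma cubic_holomorphic_differential:
  assumes D: "D = smult k ([:- a, 1:] * [:- b, 1:] * [:- c, 1:])" "k \<noteq> 0"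
    and distinct: "a \<noteq> b" "a \<noteq> c" "b \<noteq> c" and p: "p \<noteq> 0"
  shows "(0, to_fract [:0, 1:] / to_fract (D * p)) \<in> holomorphic_differentials (hyperelliptic_curve D p)"
proof -
  let ?w = "to_fract [:0, 1:] / to_fract (D * p)"
  have "\<exists>h. h analytic_on {0} \<and>
      (\<forall>\<^sub>F t in at 0. (eval_fract 0 (l t) + eval_fract ?w (l t) * n t) * deriv l t = h t)"
    if param: "branch_param (hyperelliptic_curve D p) n l" for n l
  proof -
    have mero: "l meromorphic_on {0}" "n meromorphic_on {0}"
      and nconst: "\<not> (\<forall>\<^sub>F t in at 0. l t = z)" for z
      using param by (auto simp: branch_param_def)
    define g where "g = (\<lambda>t. l t / poly (D * p) (l t) * n t * deriv l t)"
    have "D \<noteq> 0"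
      using D(2) by (simp add: D(1))
    then have "D * p \<noteq> 0"
      using p by simp
    then have nz: "\<forall>\<^sub>F t in at 0. poly (D * p) (l t) \<noteq> 0"
      by (intro eventually_poly_nonzero mero nconst)
    then have g: "\<forall>\<^sub>F t in at 0. (eval_fract 0 (l t) + eval_fract ?w (l t) * n t) * deriv l t = g t"
    proof eventually_elim
      case (elim t)
      then have "eval_fract ?w (l t) = poly [:0, 1:] (l t) / poly (D * p) (l t)"
        by (rule eval_fract_divide)
      then show ?case
        by (simp add: g_def eval_fract_def)
    qed
    have "g meromorphic_on {0}"
      unfolding g_def by (intro meromorphic_intros mero)
    moreover have "(\<lambda>t. t * (g t)\<^sup>2) \<in> O[at 0](\<lambda>_. 1)"
    proof -
      have "(\<lambda>t. inverse k * (t * (deriv l t)\<^sup>2 / ((l t - a) * (l t - b) * (l t - c)))) \<in> O[at 0](\<lambda>_. 1)"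
        using cubic_differential_bigo[OF mero(1) _ distinct] nconst D(2)
        by (subst landau_o.big.cmult_in_iff) (simp_all add: frequently_def)
      moreover have "\<forall>\<^sub>F t in at 0. (n t, l t) \<in> hyperelliptic_curve D p"
        using param by (simp add: branch_param_def)
      with nz have "\<forall>\<^sub>F t in at 0. inverse k * (t * (deriv l t)\<^sup>2 / ((l t - a) * (l t - b) * (l t - c))) = t * (g t)\<^sup>2"
      proof eventually_elim
        case (elim t)
        have n: "(l t * n t)\<^sup>2 = poly D (l t) * (poly p (l t))\<^sup>2"
          using elim(2) by (auto simp: hyperelliptic_curve_def)
        have "(g t)\<^sup>2 = (l t * n t)\<^sup>2 * (deriv l t)\<^sup>2 / (poly (D * p) (l t))\<^sup>2"
          by (simp add: g_def power_mult_distrib power_divide)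
        also have "\<dots> = (deriv l t)\<^sup>2 / poly D (l t)"
          unfolding n using elim(1) by (simp add: power_mult_distrib power2_eq_square)
        also have "poly D (l t) = k * ((l t - a) * (l t - b) * (l t - c))"
          by (simp add: D(1) algebra_simps)
        finally show ?case
          using D(2) by (simp add: divide_inverse)
      qed
      ultimately show ?thesis
        using landau_o.big.in_cong by fast
    qed
    ultimately obtain h where "h analytic_on {0}" "\<forall>\<^sub>F t in at 0. g t = h t"
      by (rule meromorphic_extends_if_square_bigo)
    with g show ?thesis
      by (intro exI[of _ h] conjI) (auto elim: eventually_elim2)
  qed
  then show ?thesis
    by (simp add: holomorphic_differentials_def)
qed

section \<open>The dimension of the space of differentials\<close>

lemma holomorphic_differentials_subset_span:
  assumes "D \<noteq> 0" "p \<noteq> 0" "degree D \<le> 3"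
  shows "holomorphic_differentials (hyperelliptic_curve D p) \<subseteq>
    module.span differential_scale {(0, to_fract [:0, 1:] / to_fract (D * p))}"
proof -
  interpret vector_space differential_scale
    by (rule vector_space_differential_scale)
  have "(u, v) \<in> span {(0, to_fract [:0, 1:] / to_fract (D * p))}"
    if uv: "(u, v) \<in> holomorphic_differentials (hyperelliptic_curve D p)" for u v
  proof -
    have "u = 0"
      using assms(1) uv by (rule holomorphic_differential_even_part_eq_0)
    moreover obtain c where "v = to_fract [:c:] * (to_fract [:0, 1:] / to_fract (D * p))"
      using assms uv by (rule holomorphic_differential_odd_part)
    ultimately have "(u, v) = differential_scale c (0, to_fract [:0, 1:] / to_fract (D * p))"
      by (simp add: differential_scale_def)
    then show ?thesis
      by (simp only: span_scale span_base insertI1)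
  qed
  then show ?thesis by auto
qed

lemma genus_le_1:
  assumes "D \<noteq> 0" "p \<noteq> 0" "degree D \<le> 3"
  shows "genus (hyperelliptic_curve D p) \<le> 1"
proof -
  interpret vector_space differential_scale
    by (rule vector_space_differential_scale)
  show ?thesis
    unfolding genus_def
    using dim_le_card[OF holomorphic_differentials_subset_span[OF assms]] by simp
qed

text \<open>For distinct roots the generator of the span is itself holomorphic, and it is nonzero,
  so it is a basis.\<close>

lemma genus_cubic:
  assumes D: "D = smult k ([:- a, 1:] * [:- b, 1:] * [:- c, 1:])" "k \<noteq> 0"
    and distinct: "a \<noteq> b" "a \<noteq> c" "b \<noteq> c" and p: "p \<noteq> 0"
  shows "genus (hyperelliptic_curve D p) = 1"
proof -
  interpret vector_space differential_scale
    by (rule vector_space_differential_scale)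
  have "D \<noteq> 0" "degree D \<le> 3"
    using D(2) by (simp_all add: D(1))
  note upper = holomorphic_differentials_subset_span[OF \<open>D \<noteq> 0\<close> p \<open>degree D \<le> 3\<close>]
  have "to_fract [:0, 1:] / to_fract (D * p) \<noteq> 0"
    using \<open>D \<noteq> 0\<close> p by simp
  then have "independent {(0, to_fract [:0, 1:] / to_fract (D * p))}"
    by (subst dependent_single) (simp add: zero_prod_def)
  then show ?thesis
    unfolding genus_def using cubic_holomorphic_differential[OF assms] upper
    by (intro dim_unique[of "{(0, to_fract [:0, 1:] / to_fract (D * p))}"]) simp_all
qed

section \<open>From symmetric potentials to polynomials\<close>

no_notation fps_nth (infixl "$" 75)

text \<open>The lowest exponent is -1, so one factor \<open>l\<close> removes the pole, and the
  coefficient of index k moves to degree k + 1.\<close>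

lemma laurent_sum_eq_poly:
  fixes l :: complex
  assumes "l \<noteq> 0"
  shows "l * (\<Sum>k = -1..int d. x k * l powi k) = poly (\<Sum>j\<le>Suc d. monom (x (int j - 1)) j) l"
proof -
  have "(\<Sum>k = -1..int d. x k * l powi k) = (\<Sum>j\<le>Suc d. x (int j - 1) * l powi (int j - 1))"
    by (rule sum.reindex_bij_witness[of _ "\<lambda>j. int j - 1" "\<lambda>k. nat (k + 1)"]) auto
  also have "l * \<dots> = (\<Sum>j\<le>Suc d. x (int j - 1) * l ^ j)"
  proof -
    have "l * (x (int j - 1) * l powi (int j - 1)) = x (int j - 1) * l ^ j" for j
    proof -
      have "l powi (int j - 1 + 1) = l powi (int j - 1) * l"
        using assms by (intro power_int_add_1) blast
      then have "l ^ j = l powi (int j - 1) * l"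
        by simp
      then show ?thesis by simp
    qed
    then show ?thesis
      by (simp only: sum_distrib_left)
  qed
  finally show ?thesis
    by (simp add: poly_sum poly_monom)
qed

text \<open>With zero diagonals the \<open>(1, 1)\<close> entry reads
  \<open>(l - 1 / l) * (M21 + cnj N21) = 0\<close>, for \<open>M\<close> and \<open>N\<close> the
  values at \<open>l\<close> and its conjugate. Away from \<open>l^2 = 1\<close> this gives
  \<open>cnj N21 = - M21\<close>, and substitution into the \<open>(1, 2)\<close> entry removes the
  conjugate.\<close>

lemma off_diagonal_K_symmetric_eq:
  fixes A B :: real
  assumes K: "K_symmetric A B d \<xi>" and off: "off_diagonal d \<xi>"
    and l: "l \<noteq> 0" "l \<noteq> 1" "l \<noteq> -1"
  shows "(of_real A - of_real B * l) * (l * laurent d \<xi> l $ 1 $ 2) = (of_real A * l - of_real B) * laurent d \<xi> l $ 2 $ 1"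
proof -
  define M N where "M = laurent d \<xi> l" and "N = laurent d \<xi> (cnj l)"
  have diag: "M $ 1 $ 1 = 0" "M $ 2 $ 2 = 0" "N $ 1 $ 1 = 0" "N $ 2 $ 2 = 0"
    using off l(1) by (auto simp: off_diagonal_def M_def N_def)
  have eq: "K_matrix A B l ** M + conj_transpose N ** K_matrix A B l = 0"
    using K l(1) by (simp add: K_symmetric_def M_def N_def)
  have "(l - inverse l) * (M $ 2 $ 1 + cnj (N $ 2 $ 1)) = 0"
    using arg_cong[OF eq, of "\<lambda>X :: complex^2^2. X $ 1 $ 1"] diag
    by (simp add: matrix_matrix_mult_def sum_2 K_matrix_def conj_transpose_def algebra_simps)
  moreover have "l - inverse l \<noteq> 0"
  proof
    assume "l - inverse l = 0"
    then have "l * l = 1"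
      using l(1) by (simp add: field_simps)
    then show False
      using l(2,3) by (simp add: square_eq_1_iff)
  qed
  ultimately have N: "cnj (N $ 2 $ 1) = - M $ 2 $ 1"
    by (simp add: eq_neg_iff_add_eq_0 add.commute)
  have "(4 * of_real A - 4 * of_real B * l) * M $ 1 $ 2 + cnj (N $ 2 $ 1) * (4 * of_real A - 4 * of_real B * inverse l) = 0"
    using arg_cong[OF eq, of "\<lambda>X :: complex^2^2. X $ 1 $ 2"] diag
    by (simp add: matrix_matrix_mult_def sum_2 K_matrix_def conj_transpose_def)
  then have "(4 * of_real A - 4 * of_real B * l) * M $ 1 $ 2 = M $ 2 $ 1 * (4 * of_real A - 4 * of_real B * inverse l)"
    unfolding N by simp
  then have "l * ((4 * of_real A - 4 * of_real B * l) * M $ 1 $ 2) =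
      M $ 2 $ 1 * (l * (4 * of_real A - 4 * of_real B * inverse l))"
    by (simp only: mult_ac)
  also have "l * (4 * of_real A - 4 * of_real B * inverse l) = 4 * (of_real A * l - of_real B)"
    using l(1) by (simp add: field_simps)
  finally have "4 * ((of_real A - of_real B * l) * (l * M $ 1 $ 2)) = 4 * ((of_real A * l - of_real B) * M $ 2 $ 1)"
    by (simp add: algebra_simps)
  then show ?thesis
    unfolding M_def mult_cancel_left by simp
qed

text \<open>\<open>P\<close> is \<open>l\<close> times the upper right entry, and
  \<open>P(0)\<close> is the nonzero entry of the coefficient of index -1. That coefficient has
  lower left entry 0, so the lower left entry of the potential is already a polynomial
  \<open>C\<close>.\<close>

lemma off_diagonal_polynomials:
  fixes A B :: real
  assumes pot: "potential d \<xi>" and K: "K_symmetric A B d \<xi>" and off: "off_diagonal d \<xi>"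
  obtains P C where "[:of_real A, - of_real B:] * P = [:- of_real B, of_real A:] * C"
    and "poly P 0 \<noteq> 0"
    and "\<And>l. l \<noteq> 0 \<Longrightarrow> l * - det (laurent d \<xi> l) = poly P l * poly C l"
proof -
  define P where "P = (\<Sum>j\<le>Suc d. monom (\<xi> (int j - 1) $ 1 $ 2) j)"
  define Q where "Q = (\<Sum>j\<le>Suc d. monom (\<xi> (int j - 1) $ 2 $ 1) j)"
  obtain y :: real where y: "y > 0" "\<xi> (-1) = vector [vector [0, \<i> * of_real y], vector [0, 0]]"
    using pot unfolding potential_def by blast
  have at_0: "poly (\<Sum>j\<le>Suc d. monom (x (int j - 1)) j) 0 = x (-1)" for x :: "int \<Rightarrow> complex"
  proof -
    have "poly (\<Sum>j\<le>Suc d. monom (x (int j - 1)) j) 0 = (\<Sum>j\<le>Suc d. if j = 0 then x (int j - 1) else 0)"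
      unfolding poly_0_coeff_0 coeff_sum by (intro sum.cong refl) simp
    also have "\<dots> = x (-1)"
      by (subst sum.delta) simp_all
    finally show ?thesis .
  qed
  have P0: "poly P 0 = \<i> * of_real y"
    unfolding P_def using at_0[of "\<lambda>k. \<xi> k $ 1 $ 2"] by (simp only: y(2) vector_2)
  have "poly Q 0 = 0"
    unfolding Q_def using at_0[of "\<lambda>k. \<xi> k $ 2 $ 1"] by (simp only: y(2) vector_2)
  then obtain C where C: "Q = [:0, 1:] * C"
    by (auto simp: poly_eq_0_iff_dvd elim: dvdE)
  have lP: "l * laurent d \<xi> l $ 1 $ 2 = poly P l" if "l \<noteq> 0" for l
    using laurent_sum_eq_poly[OF that, where x = "\<lambda>k. \<xi> k $ 1 $ 2"]
    by (simp only: laurent_def vec_lambda_beta P_def)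
  have lC: "laurent d \<xi> l $ 2 $ 1 = poly C l" if "l \<noteq> 0" for l
  proof -
    have "l * laurent d \<xi> l $ 2 $ 1 = poly Q l"
      using laurent_sum_eq_poly[OF that, where x = "\<lambda>k. \<xi> k $ 2 $ 1"]
      by (simp only: laurent_def vec_lambda_beta Q_def)
    then show ?thesis
      using that by (simp add: C)
  qed
  show ?thesis
  proof
    define E where "E = [:of_real A, - of_real B:] * P - [:- of_real B, of_real A:] * C"
    \<comment> \<open>The relation is known only off 0, 1 and -1. The additional factor vanishes at
      these points, so the product is zero everywhere and hence as a polynomial.\<close>
    have "poly (E * ([:0, 1:] * [:-1, 1:] * [:1, 1:])) l = 0" for l
    proof (cases "l = 0 \<or> l = 1 \<or> l = -1")
      case False
      then have "l \<noteq> 0" "l \<noteq> 1" "l \<noteq> -1" by auto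
      from off_diagonal_K_symmetric_eq[OF K off this]
      have "poly E l = 0"
        unfolding lP[OF \<open>l \<noteq> 0\<close>] lC[OF \<open>l \<noteq> 0\<close>] by (simp add: E_def algebra_simps)
      then show ?thesis by simp
    qed auto
    then have "E * ([:0, 1:] * [:-1, 1:] * [:1, 1:]) = 0"
      using poly_all_0_iff_0 by blast
    then have "E = 0"
      by (simp only: mult_eq_0_iff) simp
    then show "[:of_real A, - of_real B:] * P = [:- of_real B, of_real A:] * C"
      by (simp add: E_def)
    show "poly P 0 \<noteq> 0"
      using y(1) by (simp add: P0)
    fix l :: complex
    assume l: "l \<noteq> 0"
    have "laurent d \<xi> l $ 1 $ 1 = 0"
      using off l by (simp add: off_diagonal_def)
    then have "l * - det (laurent d \<xi> l) = (l * laurent d \<xi> l $ 1 $ 2) * laurent d \<xi> l $ 2 $ 1"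
      by (simp add: det_2)
    then show "l * - det (laurent d \<xi> l) = poly P l * poly C l"
      by (simp only: lP[OF l] lC[OF l])
  qed
qed

text \<open>Multiplying \<open>n^2 = - det\<close> by the nonzero \<open>l^2\<close> turns its right
  side into \<open>l * R\<close>, which is \<open>D * p^2\<close>.\<close>

lemma spectral_curve_eq_hyperelliptic_curve:
  assumes det: "\<And>l. l \<noteq> 0 \<Longrightarrow> l * - det (laurent d \<xi> l) = poly R l"
    and D: "D * p\<^sup>2 = [:0, 1:] * R"
  shows "spectral_curve d \<xi> = hyperelliptic_curve D p"
proof -
  have "n\<^sup>2 = - det (laurent d \<xi> l) \<longleftrightarrow> (l * n)\<^sup>2 = poly D l * (poly p l)\<^sup>2" if l: "l \<noteq> 0" for n l
  proof -
    have "poly D l * (poly p l)\<^sup>2 = l * poly R l"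
      using arg_cong[OF D, of "\<lambda>q. poly q l"] by simp
    also have "\<dots> = l\<^sup>2 * - det (laurent d \<xi> l)"
      by (simp only: det[OF l, symmetric] power2_eq_square mult.assoc)
    finally have "poly D l * (poly p l)\<^sup>2 = l\<^sup>2 * - det (laurent d \<xi> l)" .
    then have "(l * n)\<^sup>2 = poly D l * (poly p l)\<^sup>2 \<longleftrightarrow> l\<^sup>2 * n\<^sup>2 = l\<^sup>2 * - det (laurent d \<xi> l)"
      by (simp only: power_mult_distrib)
    then show ?thesis
      using l by (simp only: mult_cancel_left power_eq_0_iff) simp
  qed
  then show ?thesis
    by (auto simp: spectral_curve_def hyperelliptic_curve_def)
qed

section \<open>The genus for off-diagonal potentials\<close>

text \<open>By coprimality \<open>a l - b\<close> divides \<open>P\<close>, and the cofactor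
  \<open>p\<close> reappears in \<open>C = (a - b l) p\<close>. The branch points 0,
  \<open>b / a\<close>, \<open>a / b\<close> are distinct; with infinity they are the four of an
  elliptic curve.\<close>

lemma genus_off_diagonal_generic:
  fixes A B :: real
  assumes AB: "A \<noteq> 0" "\<bar>A\<bar> \<noteq> \<bar>B\<bar>"
    and pot: "potential d \<xi>" and K: "K_symmetric A B d \<xi>" and off: "off_diagonal d \<xi>"
  shows "genus (spectral_curve d \<xi>) = 1"
proof -
  define a b where "a = complex_of_real A" and "b = complex_of_real B"
  obtain P C where PC: "[:a, - b:] * P = [:- b, a:] * C" and P0: "poly P 0 \<noteq> 0"
    and det: "\<And>l. l \<noteq> 0 \<Longrightarrow> l * - det (laurent d \<xi> l) = poly P l * poly C l"
    using off_diagonal_polynomials[OF pot K off] unfolding a_def b_def by blast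
  have a: "a \<noteq> 0"
    using AB by (simp add: a_def)
  \<comment> \<open>For \<open>b = 0\<close> the relation at \<open>l = 0\<close> would give
    \<open>P(0) = 0\<close>, so no such potential exists when \<open>B = 0\<close>.\<close>
  have b: "b \<noteq> 0"
  proof
    assume "b = 0"
    with arg_cong[OF PC, of "\<lambda>q. poly q 0"] a P0 show False by simp
  qed
  have ab: "a * a \<noteq> b * b"
  proof
    assume "a * a = b * b"
    then have "complex_of_real (A\<^sup>2) = complex_of_real (B\<^sup>2)"
      by (simp add: a_def b_def power2_eq_square)
    then have "A\<^sup>2 = B\<^sup>2"
      by (simp only: of_real_eq_iff)
    with AB(2) show False
      by (metis real_sqrt_abs)
  qed
  \<comment> \<open>\<open>b / a\<close> is the root of \<open>a l - b\<close>, and the other factor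
    does not vanish there because \<open>a^2 \<noteq> b^2\<close>.\<close>
  have "(a - b * (b / a)) * poly P (b / a) = 0"
    using arg_cong[OF PC, of "\<lambda>q. poly q (b / a)"] a by (simp add: algebra_simps)
  moreover have "a - b * (b / a) \<noteq> 0"
    using ab a by (simp add: field_simps)
  ultimately have "poly P (b / a) = 0" by simp
  then obtain q where q: "P = [:- (b / a), 1:] * q"
    by (auto simp: poly_eq_0_iff_dvd elim: dvdE)
  define p where "p = smult (inverse a) q"
  have ba: "[:- b, a:] = smult a [:- (b / a), 1:]" and ab': "[:a, - b:] = smult (- b) [:- (a / b), 1:]"
    using a b by simp_all
  then have P: "P = [:- b, a:] * p"
    using a by (simp only: ba q p_def mult_smult_left mult_smult_right smult_smult) simp
  have "[:- b, a:] * C = [:- b, a:] * ([:a, - b:] * p)"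
    using PC by (simp only: P mult_ac)
  then have C: "C = [:a, - b:] * p"
    using a by (subst (asm) mult_left_cancel) simp_all
  have p: "p \<noteq> 0"
    using P0 P by auto
  define D where "D = [:0, 1:] * ([:- b, a:] * [:a, - b:])"
  \<comment> \<open>\<open>[:- 0, 1:]\<close> is \<open>l\<close>, written in the shape of a linear
    factor of \<open>genus_cubic\<close>.\<close>
  have D_monic: "D = smult (- (a * b)) ([:- 0, 1:] * [:- (b / a), 1:] * [:- (a / b), 1:])"
    unfolding D_def ba ab'
    by (simp only: mult_smult_left mult_smult_right smult_smult minus_zero mult_minus_left
        mult_minus_right mult_ac)
  have "D * p\<^sup>2 = [:0, 1:] * (P * C)"
    by (simp only: D_def P C power2_eq_square mult_ac)
  then have "spectral_curve d \<xi> = hyperelliptic_curve D p"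
    using det by (intro spectral_curve_eq_hyperelliptic_curve[of _ _ "P * C"]) simp_all
  moreover have "b / a \<noteq> a / b"
    using a b ab by (simp add: field_simps)
  then have "genus (hyperelliptic_curve D p) = 1"
    using a b p by (intro genus_cubic[OF D_monic]) simp_all
  ultimately show ?thesis by simp
qed

text \<open>When \<open>A = 0\<close>, \<open>B = A\<close> or \<open>B = - A\<close>, the relation
  makes \<open>C\<close> equal to \<open>l P\<close>, \<open>- P\<close> or \<open>P\<close>. Then
  \<open>l P C\<close> is \<open>P^2\<close> times \<open>l^2\<close>, \<open>- l\<close> or
  \<open>l\<close>, and the bound for degree at most 3 applies with \<open>p = P\<close>.\<close>

lemma genus_off_diagonal_le_1:
  fixes A B :: real
  assumes AB: "A \<noteq> 0 \<or> B \<noteq> 0"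
    and pot: "potential d \<xi>" and K: "K_symmetric A B d \<xi>" and off: "off_diagonal d \<xi>"
  shows "genus (spectral_curve d \<xi>) \<le> 1"
proof -
  obtain P C where PC: "[:of_real A, - of_real B:] * P = [:- of_real B, of_real A:] * C"
    and P0: "poly P 0 \<noteq> 0"
    and det: "\<And>l. l \<noteq> 0 \<Longrightarrow> l * - det (laurent d \<xi> l) = poly P l * poly C l"
    using off_diagonal_polynomials[OF pot K off] by blast
  have "P \<noteq> 0"
    using P0 by auto
  have le: "genus (spectral_curve d \<xi>) \<le> 1" if "D * P\<^sup>2 = [:0, 1:] * (P * C)" "D \<noteq> 0" "degree D \<le> 3" for D
  proof -
    have "spectral_curve d \<xi> = hyperelliptic_curve D P"
      using det that(1) by (intro spectral_curve_eq_hyperelliptic_curve[of _ _ "P * C"]) simp_all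
    then show ?thesis
      using genus_le_1[OF that(2) \<open>P \<noteq> 0\<close> that(3)] by simp
  qed
  consider "A \<noteq> 0" "\<bar>A\<bar> \<noteq> \<bar>B\<bar>" | "A = 0" "B \<noteq> 0" | "A \<noteq> 0" "B = A" | "A \<noteq> 0" "B = - A"
    using AB by fastforce
  then show ?thesis
  proof cases
    case 1
    then show ?thesis
      using genus_off_diagonal_generic[OF _ _ pot K off] by simp
  next
    case 2
    have "[:- of_real B:] * C = [:- of_real B:] * ([:0, 1:] * P)"
      using PC 2 by simp
    then have C: "C = [:0, 1:] * P"
      using 2 by (subst (asm) mult_left_cancel) simp_all
    show ?thesis
      by (rule le[of "[:0, 1:] * [:0, 1:]"]) (simp_all only: C power2_eq_square mult_ac, simp_all)
  next
    case 3
    have "[:of_real A, - of_real A:] = - [:- complex_of_real A, of_real A:]"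
      by simp
    then have "[:- of_real A, of_real A:] * C = [:- of_real A, of_real A:] * - P"
      using PC unfolding 3(2) by (simp only: mult_minus_left mult_minus_right)
    then have C: "C = - P"
      using 3 by (subst (asm) mult_left_cancel) simp_all
    show ?thesis
      by (rule le[of "- [:0, 1:]"]) (simp_all add: C power2_eq_square)
  next
    case 4
    have "[:of_real A, of_real A:] * C = [:of_real A, of_real A:] * P"
      using PC unfolding 4(2) by (simp only: of_real_minus minus_minus)
    then have C: "C = P"
      using 4 by (subst (asm) mult_left_cancel) simp_all
    show ?thesis
      by (rule le[of "[:0, 1:]"]) (simp_all add: C power2_eq_square)
  qed
qed

text \<open>Genus exactly one is claimed where three distinct finite branch points arise. In the
  degenerate cases the bound by one, read contrapositively, still gives the statement on higher
  genus. For \<open>A = B = 0\<close> the linear relation between \<open>P\<close> and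
  \<open>C\<close> would be empty.\<close>

theorem corollary3p4:
  fixes A B :: real
  shows "(A \<noteq> 0 \<and> \<bar>A\<bar> \<noteq> \<bar>B\<bar> \<longrightarrow>
            (\<forall>d \<xi>. potential d \<xi> \<and> K_symmetric A B d \<xi> \<and> off_diagonal d \<xi> \<longrightarrow>
               genus (spectral_curve d \<xi>) = 1)) \<and>
         (A \<noteq> 0 \<or> B \<noteq> 0 \<longrightarrow>
            (\<forall>d \<xi>. potential d \<xi> \<and> K_symmetric A B d \<xi> \<and> genus (spectral_curve d \<xi>) > 1 \<longrightarrow>
               \<not> off_diagonal d \<xi>))"
  using genus_off_diagonal_generic genus_off_diagonal_le_1 by (metis not_less)

end
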